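(* Let $r\ge 2$ and let $F_r$ be the free group of rank $r$ with the word metric of a free generating set. Let $n,k\ge 0$ be integers and let $A,B\subseteq F_r$ be finite non-empty sets with $A\subseteq B_n$ and $B\subseteq B_k$. Then $$|AB|\ge\frac{|A|\,|B|}{4(n+k)+1}.$$ Moreover, if $A\subseteq S_n$ and $B\subseteq S_k$, and if $m=\min\{n,k\}$, then $$|AB|\ge\left(\frac23+\frac1{3\cdot 4^m}\right)|A|\,|B|.$$ The constant in this last estimate is sharp for every $m$: for every integer $m\ge0$, the constant $\frac23+\frac1{3\cdot4^m}$ cannot be replaced by a larger one valid for all $n,k$ with $\min\{n,k\}=m$ and all finite non-empty $A\subseteq S_n$, $B\subseteq S_k$.
   Context: $|g|$ denotes word length with respect to the fixed free generating set of $F_r$, $B_m=\{g\in F_r:|g|\le m\}$, $S_m=\{g\in F_r:|g|=m\}$, and $AB=\{ab:a\in A,b\in B\}$. *)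

theory Defs
  imports Complex_Main "HOL-Algebra.Coset" "HOL-Algebra.Generated_Groups" "HOL-Algebra.Bij"
begin

text \<open>
  A word over \<open>S\<close> is a list of formal letters \<open>(x, True)\<close>, standing for \<open>x\<close>, and
  \<open>(x, False)\<close>, standing for the inverse of \<open>x\<close>, with \<open>x \<in> S\<close>.
\<close>

definition words :: "'a set \<Rightarrow> ('a \<times> bool) list set" where
  "words S = {w. set w \<subseteq> S \<times> UNIV}"

definition letter_val :: "('a, 'b) monoid_scheme \<Rightarrow> 'a \<times> bool \<Rightarrow> 'a" where
  "letter_val G l = (if snd l then fst l else inv\<^bsub>G\<^esub> (fst l))"

definition word_val :: "('a, 'b) monoid_scheme \<Rightarrow> ('a \<times> bool) list \<Rightarrow> 'a" where
  "word_val G w = foldr (\<lambda>l g. letter_val G l \<otimes>\<^bsub>G\<^esub> g) w \<one>\<^bsub>G\<^esub>"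

definition reduced :: "('a \<times> bool) list \<Rightarrow> bool" where
  "reduced w \<longleftrightarrow> successively (\<lambda>l m. m \<noteq> (fst l, \<not> snd l)) w"

text \<open>
  \<open>G\<close> is a free group with free generating set (basis) \<open>S\<close>: the set \<open>S\<close> generates \<open>G\<close>, and no
  non-empty reduced word over \<open>S\<close> is trivial in \<open>G\<close>. The rank is \<open>card S\<close>.
\<close>

definition free_generating_set :: "('a, 'b) monoid_scheme \<Rightarrow> 'a set \<Rightarrow> bool" where
  "free_generating_set G S \<longleftrightarrow>
     group G \<and> S \<subseteq> carrier G \<and> generate G S = carrier G \<and>
     (\<forall>w \<in> words S. reduced w \<and> w \<noteq> [] \<longrightarrow> word_val G w \<noteq> \<one>\<^bsub>G\<^esub>)"

definition word_length :: "('a, 'b) monoid_scheme \<Rightarrow> 'a set \<Rightarrow> 'a \<Rightarrow> nat" where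
  "word_length G S g = (LEAST n. \<exists>w \<in> words S. length w = n \<and> word_val G w = g)"

definition word_ball :: "('a, 'b) monoid_scheme \<Rightarrow> 'a set \<Rightarrow> nat \<Rightarrow> 'a set" where
  "word_ball G S m = {g \<in> carrier G. word_length G S g \<le> m}"

definition word_sphere :: "('a, 'b) monoid_scheme \<Rightarrow> 'a set \<Rightarrow> nat \<Rightarrow> 'a set" where
  "word_sphere G S m = {g \<in> carrier G. word_length G S g = m}"


text \<open>
  Free groups of every finite rank exist: let the letters act on reduced words by left
  multiplication and take the group of permutations generated by this action.
\<close>

definition flip :: "'a \<times> bool \<Rightarrow> 'a \<times> bool" where
  "flip l = (fst l, \<not> snd l)"

definition push :: "'a \<times> bool \<Rightarrow> ('a \<times> bool) list \<Rightarrow> ('a \<times> bool) list" where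
  "push l w = (if w \<noteq> [] \<and> hd w = flip l then tl w else l # w)"

lemma flip_flip [simp]: "flip (flip l) = l"
  by (simp add: flip_def)

lemma flip_neq [simp]: "flip l \<noteq> l" "l \<noteq> flip l"
  by (auto simp: flip_def prod_eq_iff)

lemma reduced_Nil [simp]: "reduced []"
  by (simp add: reduced_def)

lemma reduced_Cons: "reduced (l # w) \<longleftrightarrow> (w = [] \<or> hd w \<noteq> flip l) \<and> reduced w"
  by (cases w) (auto simp: reduced_def flip_def)

definition reduced_words :: "'a set \<Rightarrow> ('a \<times> bool) list set" where
  "reduced_words S = {w \<in> words S. reduced w}"

lemma push_in: "fst l \<in> S \<Longrightarrow> w \<in> reduced_words S \<Longrightarrow> push l w \<in> reduced_words S"
  by (cases w) (auto simp: reduced_words_def push_def reduced_Cons words_def mem_Times_iff)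

lemma push_flip: "w \<in> reduced_words S \<Longrightarrow> push (flip l) (push l w) = w"
  by (cases w) (auto simp: reduced_words_def push_def reduced_Cons)

definition act :: "'a set \<Rightarrow> 'a \<times> bool \<Rightarrow> ('a \<times> bool) list \<Rightarrow> ('a \<times> bool) list" where
  "act S l = restrict (push l) (reduced_words S)"

lemma act_Bij: "fst l \<in> S \<Longrightarrow> act S l \<in> Bij (reduced_words S)"
proof -
  assume l: "fst l \<in> S"
  then have l': "fst (flip l) \<in> S" by (simp add: flip_def)
  have "bij_betw (push l) (reduced_words S) (reduced_words S)"
    by (rule bij_betw_byWitness[where f' = "push (flip l)"])
       (use push_flip[of _ S l] push_flip[of _ S "flip l"] push_in[OF l] push_in[OF l'] in auto)
  then show ?thesis by (simp add: act_def Bij_def)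
qed

lemma free_generating_set_exists:
  fixes Y :: "'a set"
  shows "\<exists>(G :: (('a \<times> bool) list \<Rightarrow> ('a \<times> bool) list) monoid) S.
           free_generating_set G S \<and> bij_betw (\<lambda>x. act Y (x, True)) Y S"
proof -
  let ?R = "reduced_words Y"
  define H where "H = BijGroup ?R"
  define S where "S = (\<lambda>x. act Y (x, True)) ` Y"
  define G where "G = H\<lparr>carrier := generate H S\<rparr>"
  interpret H: group H unfolding H_def by (rule group_BijGroup)
  have S_sub: "S \<subseteq> carrier H"
    by (auto simp: S_def H_def BijGroup_def intro!: act_Bij)
  have sub: "subgroup (generate H S) H"
    by (rule H.generate_is_subgroup[OF S_sub])
  have "group G" unfolding G_def by (rule subgroup.subgroup_is_group[OF sub H.is_group])
  have S_gen: "S \<subseteq> generate H S" by (auto intro: generate.incl)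
  have gen: "generate G S = carrier G"
    using H.generate_consistent[OF S_gen sub] by (simp add: G_def)
  have Nil_in: "[] \<in> ?R" by (simp add: reduced_words_def words_def)
  have inj: "inj_on (\<lambda>x. act Y (x, True)) Y"
  proof (rule inj_onI)
    fix x y assume "act Y (x, True) = act Y (y, True)"
    from fun_cong[OF this, of "[]"] show "x = y"
      using Nil_in by (simp add: act_def push_def)
  qed
  have mult: "(f \<otimes>\<^bsub>G\<^esub> g) u = f (g u)" if "f \<in> Bij ?R" "g \<in> Bij ?R" "u \<in> ?R" for f g u
    using that by (simp add: G_def H_def BijGroup_def compose_def)
  have inv_act: "inv\<^bsub>G\<^esub> (act Y (x, True)) = act Y (x, False)" if "x \<in> Y" for x
  proof -
    have S: "act Y (x, True) \<in> S" using that by (simp add: S_def)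
    have bij: "act Y (x, True) \<in> Bij ?R" "act Y (x, False) \<in> Bij ?R"
      using that by (auto intro: act_Bij)
    have "act Y (x, False) \<otimes>\<^bsub>H\<^esub> act Y (x, True) = \<one>\<^bsub>H\<^esub>"
      using bij push_flip[of _ Y "(x, True)"] push_in[of "(x, True)" Y] that
      by (auto simp: H_def BijGroup_def compose_def act_def flip_def restrict_def fun_eq_iff)
    then have "inv\<^bsub>H\<^esub> (act Y (x, True)) = act Y (x, False)"
      using bij by (intro H.inv_equality) (auto simp: H_def BijGroup_def)
    moreover have "inv\<^bsub>G\<^esub> (act Y (x, True)) = inv\<^bsub>H\<^esub> (act Y (x, True))"
      unfolding G_def using sub S_gen S by (intro H.m_inv_consistent) auto
    ultimately show ?thesis by simp
  qed
  define nm where "nm = inv_into Y (\<lambda>x. act Y (x, True))"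
  define nml where "nml = (\<lambda>l :: (('a \<times> bool) list \<Rightarrow> ('a \<times> bool) list) \<times> bool. (nm (fst l), snd l))"
  have nm: "nm s \<in> Y" "act Y (nm s, True) = s" if "s \<in> S" for s
    using that unfolding nm_def S_def by (auto intro: inv_into_into f_inv_into_f)
  have letter: "letter_val G l = act Y (nml l)" if "fst l \<in> S" for l
    using nm[OF that] inv_act[OF nm(1)[OF that]]
    by (cases "snd l") (auto simp: letter_val_def nml_def)
  have val: "word_val G w \<in> Bij ?R \<and> map nml w \<in> ?R \<and> word_val G w [] = map nml w"
    if "w \<in> words S" "reduced w" for w
    using that
  proof (induction w)
    case Nil
    then show ?case
      using Nil_in id_Bij[of ?R, unfolded restrict_def] by (simp add: word_val_def G_def H_def BijGroup_def)
  next
    case (Cons l w)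
    then have l: "fst l \<in> S" and w: "w \<in> words S" "reduced w" and hd: "w = [] \<or> hd w \<noteq> flip l"
      by (auto simp: words_def mem_Times_iff reduced_Cons)
    note IH = Cons.IH[OF w]
    have Y: "fst (nml l) \<in> Y" using nm[OF l] by (simp add: nml_def)
    have red: "hd (map nml w) \<noteq> flip (nml l)" if "w \<noteq> []"
    proof
      assume eq: "hd (map nml w) = flip (nml l)"
      have "fst (hd w) \<in> S" using w(1) that by (cases w) (auto simp: words_def)
      moreover have "nm (fst (hd w)) = nm (fst l)" "snd (hd w) = (\<not> snd l)"
        using eq that by (auto simp: hd_map nml_def flip_def)
      ultimately have "hd w = flip l" using nm(2) l by (metis flip_def prod.collapse)
      with hd that show False by blast
    qed
    have step: "word_val G (l # w) = act Y (nml l) \<otimes>\<^bsub>G\<^esub> word_val G w"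
      using letter[OF l] by (simp add: word_val_def)
    have "word_val G (l # w) \<in> Bij ?R"
      unfolding step using act_Bij[OF Y] IH
      by (simp add: G_def H_def BijGroup_def compose_Bij)
    moreover have push: "push (nml l) (map nml w) = map nml (l # w)"
      using red by (auto simp: push_def)
    moreover have "map nml (l # w) \<in> ?R"
      using push_in[OF Y, of "map nml w"] IH push by simp
    moreover have "word_val G (l # w) [] = map nml (l # w)"
      unfolding step using mult[OF act_Bij[OF Y], of "word_val G w" "[]"] IH Nil_in push
      by (simp add: act_def)
    ultimately show ?case by blast
  qed
  have "word_val G w \<noteq> \<one>\<^bsub>G\<^esub>" if w: "w \<in> words S" "reduced w" "w \<noteq> []" for w
  proof
    assume "word_val G w = \<one>\<^bsub>G\<^esub>"
    then have "word_val G w [] = []" using Nil_in by (simp add: G_def H_def BijGroup_def)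
    with val[OF w(1,2)] w(3) show False by simp
  qed
  then have "free_generating_set G S"
    using \<open>group G\<close> gen S_gen by (auto simp: free_generating_set_def G_def)
  moreover have "bij_betw (\<lambda>x. act Y (x, True)) Y S"
    using inj by (simp add: S_def bij_betw_def)
  ultimately show ?thesis by blast
qed

corollary free_group_of_rank_exists:
  "\<exists>(G :: ((nat \<times> bool) list \<Rightarrow> (nat \<times> bool) list) monoid) S.
     free_generating_set G S \<and> card S = r"
  using free_generating_set_exists[of "{..<r}"] bij_betw_same_card by fastforce

end

theory Submission
  imports Defs
begin

text \<open>
  A product \<open>a b\<close> of two reduced words either is the reduced word obtained by concatenation, or the
  last letter \<open>s\<close> of \<open>a\<close> cancels against the first letter of \<open>b\<close>. If \<open>x\<^sub>s\<close> elements of \<open>A\<close>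
  end in \<open>s\<close> and \<open>y\<^sub>s\<close> elements of \<open>B\<close> begin with the inverse of \<open>s\<close>, then exactly
  \<open>\<Sum>\<^sub>s x\<^sub>s y\<^sub>s\<close> of the pairs in \<open>A \<times> B\<close> cancel (\<open>card_cancelling\<close>). Both lower bounds come from
  controlling this sum.

  \<^bold>\<open>Balls.\<close> Replacing \<open>A\<close> by \<open>A g\<inverse>\<close> and \<open>B\<close> by \<open>g B\<close> does not change \<open>A B\<close>. In the Cayley tree
  this moves the base point, and \<open>a b\<close> describes the geodesic from \<open>a\<inverse>\<close> to \<open>b\<close>. Choose \<open>g\<close> to be a
  median of the points \<open>a\<inverse>\<close> and \<open>b\<close>, where each of the two sets carries the same total weight. Then
  no branch at the base point carries more than half of the weight, that is,
  \<open>x\<^sub>s / |A| + y\<^sub>s / |B| \<le> 1\<close> for every letter (\<open>balanced_translate\<close>), and this forces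
  \<open>\<Sum>\<^sub>s x\<^sub>s y\<^sub>s \<le> |A| |B| / 2\<close>. So at least half of the pairs do not cancel. Such a pair is a way to cut
  a reduced word of length at most \<open>n + k\<close> into two, and each word has at most \<open>n + k + 1\<close> cuts
  (\<open>balanced_product_bound\<close>). This gives \<open>|A| |B| \<le> 2 (n + k + 1) |A B|\<close>, which is stronger than the
  claimed bound unless \<open>n = k = 0\<close>.

  \<^bold>\<open>Spheres.\<close> When all words of \<open>A\<close> have length \<open>n\<close> and all words of \<open>B\<close> have length \<open>k\<close>, distinct
  pairs without cancellation have distinct products of length \<open>n + k\<close>, and the other products are
  shorter. For each \<open>s\<close>, the latter contain the product set of two subsets of the spheres of radius
  \<open>n - 1\<close> and \<open>k - 1\<close>, of sizes \<open>x\<^sub>s\<close> and \<open>y\<^sub>s\<close>. Hence, if \<open>c\<^sub>m\<close> is the constant for \<open>m\<close>,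
  \<open>|A B| \<ge> |A| |B| - \<Sum>\<^sub>s x\<^sub>s y\<^sub>s + c\<^sub>m\<^sub>-\<^sub>1 max\<^sub>s x\<^sub>s y\<^sub>s\<close>. The worst case has two
  letters with half of the mass each (\<open>sum_mult_minus_max\<close>), which leads to the recursion
  \<open>c\<^sub>m = 1 / 2 + c\<^sub>m\<^sub>-\<^sub>1 / 4\<close> with \<open>c\<^sub>0 = 1\<close>, solved by \<open>c\<^sub>m = 2 / 3 + 1 / (3 \<sqdot> 4\<^sup>m)\<close>.

  \<^bold>\<open>Sharpness.\<close> This worst case occurs at every level of the recursion if \<open>A\<close> consists of all positive
  words of length \<open>m\<close> in two generators and \<open>B\<close> is the set of their inverses
  (\<open>sphere_const_attained\<close>).
\<close>

section \<open>Reduced words as normal forms\<close>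

lemma reduced_append:
  "reduced (u @ v) \<longleftrightarrow>
     reduced u \<and> reduced v \<and> (u \<noteq> [] \<and> v \<noteq> [] \<longrightarrow> hd v \<noteq> flip (last u))"
  by (auto simp: reduced_def successively_append_iff flip_def)

lemma reduced_inverse: "reduced w \<Longrightarrow> reduced (map flip (rev w))"
proof (induction w)
  case (Cons l w)
  have "hd w \<noteq> flip l" if "w \<noteq> []"
    using Cons.prems that by (simp add: reduced_Cons)
  then have "flip l \<noteq> flip (last (map flip (rev w)))" if "w \<noteq> []"
    using that by (metis flip_flip last_map last_rev map_is_Nil_conv rev_is_Nil_conv)
  then show ?case
    using Cons by (auto simp: reduced_append reduced_Cons)
qed simp

lemma words_simps [simp]:
  "[] \<in> words S"
  "l # w \<in> words S \<longleftrightarrow> fst l \<in> S \<and> w \<in> words S"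
  "u @ v \<in> words S \<longleftrightarrow> u \<in> words S \<and> v \<in> words S"
  "map flip (rev w) \<in> words S \<longleftrightarrow> w \<in> words S"
  by (auto simp: words_def mem_Times_iff flip_def)

lemma fst_flip [simp]: "fst (flip l) = fst l"
  by (simp add: flip_def)

locale free_basis =
  fixes G :: "('a, 'b) monoid_scheme" (structure) and S :: "'a set"
  assumes basis: "free_generating_set G S"
begin

sublocale group G
  using basis by (simp add: free_generating_set_def)

abbreviation val where "val \<equiv> word_val G"
abbreviation len where "len \<equiv> word_length G S"

lemma S_closed: "x \<in> S \<Longrightarrow> x \<in> carrier G"
  using basis by (auto simp: free_generating_set_def)

lemma letter_closed [simp]: "fst l \<in> S \<Longrightarrow> letter_val G l \<in> carrier G"
  by (auto simp: letter_val_def S_closed)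

lemma letter_flip: "fst l \<in> S \<Longrightarrow> letter_val G (flip l) = inv (letter_val G l)"
  by (auto simp: letter_val_def flip_def S_closed)

lemma val_Nil [simp]: "val [] = \<one>"
  by (simp add: word_val_def)

lemma val_Cons [simp]: "val (l # w) = letter_val G l \<otimes> val w"
  by (simp add: word_val_def)

lemma val_closed [simp]: "w \<in> words S \<Longrightarrow> val w \<in> carrier G"
  by (induction w) auto

lemma val_append: "u \<in> words S \<Longrightarrow> v \<in> words S \<Longrightarrow> val (u @ v) = val u \<otimes> val v"
  by (induction u) (auto simp: m_assoc)

lemma val_inverse: "w \<in> words S \<Longrightarrow> val (map flip (rev w)) = inv (val w)"
  by (induction w) (auto simp: val_append letter_flip inv_mult_group)

lemma val_cancel:
  assumes "u \<in> words S" "v \<in> words S" "fst l \<in> S"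
  shows "val ((u @ [l]) @ (flip l # v)) = val (u @ v)"
proof -
  have "letter_val G l \<otimes> (inv (letter_val G l) \<otimes> val v) = val v"
    using assms by (simp flip: m_assoc)
  then show ?thesis
    using assms by (simp add: val_append letter_flip m_assoc)
qed

lemma val_eq_one: "w \<in> reduced_words S \<Longrightarrow> val w = \<one> \<Longrightarrow> w = []"
  using basis by (auto simp: free_generating_set_def reduced_words_def)

text \<open>
  For distinct first letters, the word \<open>u\<inverse> v\<close> is reduced as it stands, so it is non-trivial in a free
  group unless it is empty; equal first letters can be stripped.
\<close>

lemma val_inj: "inj_on val (reduced_words S)"
proof -
  have "u = v" if "u \<in> reduced_words S" "v \<in> reduced_words S" "val u = val v" for u v
    using that
  proof (induction u arbitrary: v)
    case Nil
    then show ?case using val_eq_one[of v] by simp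
  next
    case (Cons l u)
    show ?case
    proof (cases v)
      case Nil
      then show ?thesis using Cons.prems val_eq_one[of "l # u"] by simp
    next
      case v: (Cons l' v')
      show ?thesis
      proof (cases "l = l'")
        case True
        then show ?thesis
          using Cons v by (auto simp: reduced_words_def reduced_Cons)
      next
        case False
        let ?w = "map flip (rev (l # u)) @ v"
        have w: "l # u \<in> words S" "v \<in> words S" "reduced (l # u)" "reduced v"
          using Cons.prems by (auto simp: reduced_words_def)
        have "reduced ?w"
          using reduced_inverse[OF w(3)] w(4) False unfolding reduced_append v by simp
        moreover have "?w \<in> words S"
          using w by simp
        moreover have "val ?w = inv (val (l # u)) \<otimes> val v"
          by (subst val_append) (use w val_inverse[of "l # u"] in auto)
        then have "val ?w = \<one>"
          using w val_closed[OF w(2)] by (simp only: Cons.prems l_inv)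
        ultimately show ?thesis
          using val_eq_one[of ?w] by (auto simp: reduced_words_def v)
      qed
    qed
  qed
  then show ?thesis by (auto intro: inj_onI)
qed

lemma val_push:
  assumes "fst l \<in> S" "w \<in> words S"
  shows "val (push l w) = letter_val G l \<otimes> val w"
proof (cases "w \<noteq> [] \<and> hd w = flip l")
  case True
  then obtain v where w: "w = flip l # v" by (cases w) auto
  have "letter_val G l \<otimes> (inv (letter_val G l) \<otimes> val v) = val v"
    using assms w by (simp flip: m_assoc)
  then show ?thesis
    using assms w by (simp add: push_def letter_flip)
qed (auto simp: push_def)

lemma reduced_form:
  assumes "w \<in> words S"
  obtains w' where "w' \<in> reduced_words S" "val w' = val w" "length w' \<le> length w"
  using assms
proof (induction w arbitrary: thesis)
  case Nil
  then show ?case by (simp add: reduced_words_def)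
next
  case (Cons l w)
  then have l: "fst l \<in> S" and "w \<in> words S" by auto
  then obtain w' where w': "w' \<in> reduced_words S" "val w' = val w" "length w' \<le> length w"
    using Cons.IH by blast
  moreover have "w' \<in> words S" using w' by (simp add: reduced_words_def)
  moreover have "length (push l w') \<le> Suc (length w')" by (auto simp: push_def)
  ultimately show ?case
    using Cons.prems(1)[of "push l w'"] push_in[OF l, of w'] val_push[OF l, of w'] by simp
qed

lemma val_surj: "val ` reduced_words S = carrier G"
proof -
  have "\<exists>w \<in> words S. val w = g" if "g \<in> generate G S" for g
    using that
  proof induction
    case one
    then show ?case by (auto intro!: bexI[of _ "[]"])
  next
    case (incl h)
    then show ?case by (auto intro!: bexI[of _ "[(h, True)]"] simp: letter_val_def S_closed)
  next
    case (inv h)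
    then show ?case by (auto intro!: bexI[of _ "[(h, False)]"] simp: letter_val_def S_closed)
  next
    case (eng g h)
    then obtain u v where "u \<in> words S" "val u = g" "v \<in> words S" "val v = h" by blast
    then show ?case by (auto intro!: bexI[of _ "u @ v"] simp: val_append)
  qed
  moreover have "generate G S = carrier G"
    using basis by (simp add: free_generating_set_def)
  ultimately have "carrier G \<subseteq> val ` words S" by blast
  moreover have "val ` words S \<subseteq> val ` reduced_words S"
    using reduced_form by (metis image_subsetI image_eqI)
  ultimately show ?thesis by (auto simp: reduced_words_def)
qed

lemma len_val:
  assumes "w \<in> reduced_words S"
  shows "len (val w) = length w"
  unfolding word_length_def
proof (rule Least_equality)
  show "\<exists>v \<in> words S. length v = length w \<and> val v = val w"
    using assms by (auto simp: reduced_words_def)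
next
  fix m assume "\<exists>v \<in> words S. length v = m \<and> val v = val w"
  then obtain v where v: "v \<in> words S" "length v = m" "val v = val w" by blast
  from reduced_form[OF v(1)] obtain v' where
    v': "v' \<in> reduced_words S" "val v' = val v" "length v' \<le> length v" .
  then have "v' = w" using inj_onD[OF val_inj _ v'(1) assms] v(3) by simp
  with v v' show "length w \<le> m" by simp
qed

text \<open>
  By \<open>val_inj\<close> and \<open>val_surj\<close>, subsets of the group correspond to sets of reduced words; the counting is
  done with the latter.
\<close>

definition normal_forms :: "'a set \<Rightarrow> ('a \<times> bool) list set" where
  "normal_forms A = {w \<in> reduced_words S. val w \<in> A}"

lemma val_normal_forms: "A \<subseteq> carrier G \<Longrightarrow> val ` normal_forms A = A"
  using val_surj by (fastforce simp: normal_forms_def)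

lemma normal_forms_bij: "A \<subseteq> carrier G \<Longrightarrow> bij_betw val (normal_forms A) A"
  using val_normal_forms[of A] inj_on_subset[OF val_inj, of "normal_forms A"]
  by (auto simp: bij_betw_def normal_forms_def)

lemma normal_forms_reduced: "normal_forms A \<subseteq> reduced_words S"
  by (auto simp: normal_forms_def)

lemma card_normal_forms: "A \<subseteq> carrier G \<Longrightarrow> card (normal_forms A) = card A"
  by (rule bij_betw_same_card[OF normal_forms_bij])

lemma finite_normal_forms: "A \<subseteq> carrier G \<Longrightarrow> finite A \<Longrightarrow> finite (normal_forms A)"
  using bij_betw_finite[OF normal_forms_bij] by blast

definition products :: "('a \<times> bool) list set \<Rightarrow> ('a \<times> bool) list set \<Rightarrow> 'a set" where
  "products A B = (\<lambda>(a, b). val (a @ b)) ` (A \<times> B)"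

lemma products_eq_set_mult:
  assumes "A \<subseteq> words S" "B \<subseteq> words S"
  shows "products A B = val ` A <#> val ` B"
proof -
  have "products A B = (\<lambda>(a, b). val a \<otimes> val b) ` (A \<times> B)"
    unfolding products_def using assms by (intro image_cong) (auto simp: val_append subset_iff)
  then show ?thesis
    by (auto simp: set_mult_def)
qed

lemma set_mult_normal_forms:
  assumes "A \<subseteq> carrier G" "B \<subseteq> carrier G"
  shows "A <#> B = products (normal_forms A) (normal_forms B)"
  using assms products_eq_set_mult[of "normal_forms A" "normal_forms B"]
  by (auto simp: val_normal_forms) (auto simp: normal_forms_def reduced_words_def)

end

section \<open>Pairs of words that cancel\<close>

definition cut_last :: "'l list set \<Rightarrow> 'l \<Rightarrow> 'l list set" where
  "cut_last A s = {u. u @ [s] \<in> A}"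

definition cut_first :: "'l list set \<Rightarrow> 'l \<Rightarrow> 'l list set" where
  "cut_first B s = {v. s # v \<in> B}"

definition cancelling :: "('a \<times> bool) list set \<Rightarrow> ('a \<times> bool) list set \<Rightarrow>
    (('a \<times> bool) list \<times> ('a \<times> bool) list) set" where
  "cancelling A B = {(a, b) \<in> A \<times> B. a \<noteq> [] \<and> b \<noteq> [] \<and> hd b = flip (last a)}"

lemma finite_cut_last: "finite A \<Longrightarrow> finite (cut_last A s)"
  unfolding cut_last_def using finite_vimageI[of A "\<lambda>u. u @ [s]"]
  by (simp add: inj_def vimage_def)

lemma finite_cut_first: "finite B \<Longrightarrow> finite (cut_first B s)"
  unfolding cut_first_def using finite_vimageI[of B "(#) s"] by (simp add: inj_def vimage_def)

lemma sum_card_cut_last: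
  assumes "finite A" "finite L"
  shows "(\<Sum>s\<in>L. card (cut_last A s)) \<le> card A"
proof -
  have "(\<Sum>s\<in>L. card (cut_last A s)) = card (SIGMA s:L. cut_last A s)"
    using assms by (simp add: card_SigmaI finite_cut_last)
  also have "\<dots> \<le> card A"
    by (rule card_inj_on_le[where f = "\<lambda>(s, u). u @ [s]"])
       (use assms in \<open>auto simp: inj_on_def cut_last_def\<close>)
  finally show ?thesis .
qed

lemma sum_card_cut_first:
  assumes "finite B" "finite L"
  shows "(\<Sum>s\<in>L. card (cut_first B (flip s))) \<le> card B"
proof -
  have "(\<Sum>s\<in>L. card (cut_first B (flip s))) = card (SIGMA s:L. cut_first B (flip s))"
    using assms by (simp add: card_SigmaI finite_cut_first)
  also have "\<dots> \<le> card B"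
    by (rule card_inj_on_le[where f = "\<lambda>(s, v). flip s # v"])
       (use assms in \<open>auto simp: inj_on_def cut_first_def flip_def prod_eq_iff\<close>)
  finally show ?thesis .
qed

text \<open>
  A cancelling pair is \<open>(u s, s\<inverse> v)\<close> for a unique letter \<open>s\<close>, so the pairs split according to \<open>s\<close>.
\<close>

lemma card_cancelling:
  assumes "finite A" "finite B" "finite L" "\<And>a. a \<in> A \<Longrightarrow> set a \<subseteq> L"
  shows "card (cancelling A B) = (\<Sum>s\<in>L. card (cut_last A s) * card (cut_first B (flip s)))"
proof -
  let ?D = "SIGMA s:L. cut_last A s \<times> cut_first B (flip s)"
  let ?f = "\<lambda>(s, u, v). (u @ [s], flip s # v)"
  have "cancelling A B \<subseteq> ?f ` ?D"
  proof
    fix p assume "p \<in> cancelling A B"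
    then obtain a b where p: "p = (a, b)" "a \<in> A" "b \<in> B" "a \<noteq> []" "b \<noteq> []" "hd b = flip (last a)"
      by (auto simp: cancelling_def)
    then have "a = butlast a @ [last a]" "b = flip (last a) # tl b" "last a \<in> L"
      using assms(4)[of a] by (auto simp flip: p(6))
    then have "(last a, butlast a, tl b) \<in> ?D" "p = ?f (last a, butlast a, tl b)"
      using p by (auto simp: cut_last_def cut_first_def)
    then show "p \<in> ?f ` ?D" by blast
  qed
  then have "cancelling A B = ?f ` ?D"
    by (auto simp: cancelling_def cut_last_def cut_first_def)
  moreover have "inj_on ?f ?D"
    by (auto simp: inj_on_def)
  ultimately have "card (cancelling A B) = card ?D"
    by (simp only: card_image)
  also have "\<dots> = (\<Sum>s\<in>L. card (cut_last A s) * card (cut_first B (flip s)))"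
    using assms by (simp add: card_SigmaI finite_cut_last finite_cut_first card_cartesian_product)
  finally show ?thesis .
qed

lemma cancelling_subset: "cancelling A B \<subseteq> A \<times> B"
  by (auto simp: cancelling_def)

lemma not_cancelling_reduced:
  assumes "A \<subseteq> reduced_words S" "B \<subseteq> reduced_words S" "(a, b) \<in> A \<times> B - cancelling A B"
  shows "a @ b \<in> reduced_words S"
  using assms by (auto simp: cancelling_def reduced_words_def reduced_append subset_iff)

section \<open>Balls\<close>

text \<open>
  With \<open>\<alpha> = x / a\<close> and \<open>\<beta> = y / b\<close>, each term satisfies
  \<open>4 \<alpha> \<beta> \<le> (\<alpha> + \<beta>)\<^sup>2 \<le> \<alpha> + \<beta>\<close> because \<open>\<alpha> + \<beta> \<le> 1\<close>, and the right-hand sides add up to at most \<open>2\<close>.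
\<close>

lemma balanced_sum_mult_le:
  fixes x y :: "'l \<Rightarrow> real"
  assumes x: "\<And>s. s \<in> L \<Longrightarrow> x s \<ge> 0" and y: "\<And>s. s \<in> L \<Longrightarrow> y s \<ge> 0"
    and "sum x L \<le> a" "sum y L \<le> b" "a > 0" "b > 0"
    and bal: "\<And>s. s \<in> L \<Longrightarrow> x s * b + y s * a \<le> a * b"
  shows "(\<Sum>s\<in>L. x s * y s) \<le> a * b / 2"
proof -
  have "4 * (x s * y s) \<le> x s * b + y s * a" if s: "s \<in> L" for s
  proof -
    let ?z = "x s * b + y s * a"
    have z0: "?z \<ge> 0" using x[OF s] y[OF s] assms(5,6) by simp
    have "4 * (x s * y s) * (a * b) \<le> ?z * ?z"
      using zero_le_square[of "x s * b - y s * a"] by (simp add: algebra_simps)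
    also have "\<dots> \<le> ?z * (a * b)"
      by (rule mult_left_mono[OF bal[OF s] z0])
    finally show ?thesis
      using assms(5,6) by (simp only: mult_le_cancel_right) (simp add: not_less)
  qed
  then have "(\<Sum>s\<in>L. 4 * (x s * y s)) \<le> (\<Sum>s\<in>L. x s * b + y s * a)"
    by (rule sum_mono)
  also have "\<dots> = sum x L * b + sum y L * a"
    by (simp add: sum.distrib sum_distrib_right)
  also have "\<dots> \<le> a * b + b * a"
    using assms(3-6) by (intro add_mono mult_right_mono) simp_all
  finally show ?thesis
    by (simp flip: sum_distrib_left)
qed

locale finite_free_basis = free_basis +
  assumes fin: "finite S"
begin

abbreviation "letters \<equiv> S \<times> (UNIV :: bool set)"

lemma reduced_words_letters: "A \<subseteq> reduced_words S \<Longrightarrow> a \<in> A \<Longrightarrow> set a \<subseteq> letters"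
  by (auto simp: reduced_words_def words_def)

text \<open>
  Without cancellation \<open>a @ b\<close> is the normal form of the product, so the pair is recovered by cutting that
  word after \<open>length a\<close> letters.
\<close>

lemma splitting_determines_pair:
  assumes "A \<subseteq> reduced_words S" "B \<subseteq> reduced_words S"
  shows "inj_on (\<lambda>(a, b). (val (a @ b), length a)) (A \<times> B - cancelling A B)"
proof (rule inj_onI)
  let ?f = "\<lambda>(a, b). (val (a @ b), length a)"
  fix p q assume p: "p \<in> A \<times> B - cancelling A B" and q: "q \<in> A \<times> B - cancelling A B"
    and eq: "?f p = ?f q"
  obtain a b where ab: "p = (a, b)" by (cases p)
  obtain a' b' where ab': "q = (a', b')" by (cases q)
  have "a @ b = a' @ b'"
    using p q eq not_cancelling_reduced[OF assms] unfolding ab ab'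
    by (intro inj_onD[OF val_inj]) simp_all
  then show "p = q" using eq by (simp add: ab ab')
qed

text \<open>
  Balance leaves at least half of the pairs without cancellation, and at most \<open>N + 1\<close> of these share a
  product, one for each position of the cut in a word of length at most \<open>N\<close>.
\<close>

lemma balanced_product_bound:
  assumes A: "finite A" "A \<subseteq> reduced_words S" "A \<noteq> {}"
    and B: "finite B" "B \<subseteq> reduced_words S" "B \<noteq> {}"
    and bal: "\<And>s. s \<in> letters \<Longrightarrow>
      card (cut_last A s) * card B + card (cut_first B (flip s)) * card A \<le> card A * card B"
    and N: "\<And>x. x \<in> products A B \<Longrightarrow> len x \<le> N"
  shows "card A * card B \<le> 2 * (N + 1) * card (products A B)"
proof -
  let ?D = "A \<times> B - cancelling A B"
  have pos: "card A > 0" "card B > 0" using A B by (auto simp: card_gt_0_iff)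
  have fL: "finite letters" using fin by simp
  have "real (card (cancelling A B))
      = (\<Sum>s\<in>letters. real (card (cut_last A s)) * real (card (cut_first B (flip s))))"
    by (subst card_cancelling[OF A(1) B(1) fL reduced_words_letters[OF A(2)]]) auto
  also have "\<dots> \<le> real (card A) * real (card B) / 2"
  proof (rule balanced_sum_mult_le)
    show "(\<Sum>s\<in>letters. real (card (cut_last A s))) \<le> real (card A)"
      using sum_card_cut_last[OF A(1) fL] by (simp flip: of_nat_sum)
    show "(\<Sum>s\<in>letters. real (card (cut_first B (flip s)))) \<le> real (card B)"
      using sum_card_cut_first[OF B(1) fL] by (simp flip: of_nat_sum)
    show "real (card (cut_last A s)) * real (card B) + real (card (cut_first B (flip s))) * real (card A)
        \<le> real (card A) * real (card B)" if "s \<in> letters" for s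
      using bal[OF that] by (simp flip: of_nat_mult of_nat_add)
  qed (use pos in auto)
  finally have "2 * card (cancelling A B) \<le> card A * card B"
    by (simp flip: of_nat_mult)
  moreover have "card ?D = card A * card B - card (cancelling A B)"
    using A B finite_subset[OF cancelling_subset, of A B]
    by (simp add: card_Diff_subset cancelling_subset card_cartesian_product)
  ultimately have "card A * card B \<le> 2 * card ?D" by linarith
  moreover have "card ?D \<le> (N + 1) * card (products A B)"
  proof -
    let ?f = "\<lambda>(a, b). (val (a @ b), length a)"
    have "card ?D \<le> card (products A B \<times> {..N})"
    proof (rule card_inj_on_le[where f = ?f])
      show "inj_on ?f ?D" by (rule splitting_determines_pair[OF A(2) B(2)])
      show "?f ` ?D \<subseteq> products A B \<times> {..N}"
      proof (rule image_subsetI)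
        fix p assume p: "p \<in> ?D"
        obtain a b where ab: "p = (a, b)" by (cases p)
        have in_P: "val (a @ b) \<in> products A B" using p by (auto simp: products_def ab)
        have "length (a @ b) = len (val (a @ b))"
          using len_val[OF not_cancelling_reduced[OF A(2) B(2), of a b]] p by (simp add: ab)
        then have "length a \<le> N" using N[OF in_P] by simp
        with in_P show "?f p \<in> products A B \<times> {..N}" by (simp add: ab)
      qed
      show "finite (products A B \<times> {..N})"
        using A B by (simp add: products_def)
    qed
    then show ?thesis by (simp add: card_cartesian_product mult.commute)
  qed
  ultimately show ?thesis by (auto intro: order_trans)
qed

text \<open>
  A step of the base point along the edge labelled \<open>s\<close> brings it closer to the points behind that edge
  and away from all others. The following lemmas record the resulting change of length, first for one
  element and then summed over a set; they say how the cost minimised by a median changes.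
\<close>

lemma len_mult_letter_right:
  assumes "w \<in> reduced_words S" "fst s \<in> S"
  shows "int (len (val w \<otimes> inv (letter_val G s)))
    = int (length w) + 1 - 2 * of_bool (\<exists>u. w = u @ [s])"
proof (cases "\<exists>u. w = u @ [s]")
  case True
  then obtain u where u: "w = u @ [s]" by blast
  then have "u \<in> reduced_words S" using assms by (auto simp: reduced_words_def reduced_append)
  moreover have "val w \<otimes> inv (letter_val G s) = val u"
    using assms u by (simp add: reduced_words_def val_append m_assoc)
  ultimately show ?thesis using len_val[of u] u by simp
next
  case False
  then have "w \<noteq> [] \<Longrightarrow> last w \<noteq> s" by (metis append_butlast_last_id)
  then have "w \<noteq> [] \<Longrightarrow> flip s \<noteq> flip (last w)" by (metis flip_flip)
  then have "w @ [flip s] \<in> reduced_words S"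
    using assms by (auto simp: reduced_words_def reduced_append reduced_Cons)
  moreover have "val w \<otimes> inv (letter_val G s) = val (w @ [flip s])"
    using assms by (simp add: reduced_words_def val_append letter_flip)
  ultimately show ?thesis using len_val[of "w @ [flip s]"] False by simp
qed

lemma len_mult_letter_left:
  assumes "w \<in> reduced_words S" "fst s \<in> S"
  shows "int (len (letter_val G s \<otimes> val w))
    = int (length w) + 1 - 2 * of_bool (\<exists>v. w = flip s # v)"
proof -
  have "len (letter_val G s \<otimes> val w) = length (push s w)"
    using assms val_push[of s w] len_val[OF push_in[of s S w]] by (simp add: reduced_words_def)
  then show ?thesis by (cases w) (auto simp: push_def)
qed

lemma sum_len_change:
  assumes A: "finite A" "A \<subseteq> carrier G"
    and f: "\<And>w. w \<in> reduced_words S \<Longrightarrow> int (f (val w)) = int (length w) + 1 - 2 * of_bool (P w)"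
  shows "int (\<Sum>a\<in>A. f a) = int (\<Sum>a\<in>A. len a) + int (card A) - 2 * int (card {w \<in> normal_forms A. P w})"
proof -
  let ?W = "normal_forms A"
  have tr: "(\<Sum>a\<in>A. h a) = (\<Sum>w\<in>?W. h (val w))" for h :: "'a \<Rightarrow> nat"
    using sum.reindex_bij_betw[OF normal_forms_bij[OF A(2)], of h] by simp
  have "int (\<Sum>a\<in>A. f a) = (\<Sum>w\<in>?W. int (len (val w)) + 1 - 2 * of_bool (P w))"
    unfolding tr of_nat_sum by (intro sum.cong refl) (simp add: f normal_forms_def len_val)
  also have "\<dots> = int (\<Sum>a\<in>A. len a) + int (card ?W) - 2 * (\<Sum>w\<in>?W. of_bool (P w))"
    by (simp add: tr sum.distrib sum_subtractf sum_distrib_left)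
  also have "(\<Sum>w\<in>?W. of_bool (P w)) = int (card {w \<in> ?W. P w})"
    using finite_normal_forms[OF A(2,1)] by (simp add: Int_def)
  finally show ?thesis by (simp add: card_normal_forms[OF A(2)])
qed

lemma sum_len_mult_right:
  assumes "finite A" "A \<subseteq> carrier G" "fst s \<in> S"
  shows "int (\<Sum>a\<in>A. len (a \<otimes> inv (letter_val G s)))
    = int (\<Sum>a\<in>A. len a) + int (card A) - 2 * int (card (cut_last (normal_forms A) s))"
proof -
  have "{w \<in> normal_forms A. \<exists>u. w = u @ [s]} = (\<lambda>u. u @ [s]) ` cut_last (normal_forms A) s"
    by (auto simp: cut_last_def)
  then show ?thesis
    using sum_len_change[OF assms(1,2) len_mult_letter_right[OF _ assms(3)]]
    by (simp add: card_image inj_on_def)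
qed

lemma sum_len_mult_left:
  assumes "finite B" "B \<subseteq> carrier G" "fst s \<in> S"
  shows "int (\<Sum>b\<in>B. len (letter_val G s \<otimes> b))
    = int (\<Sum>b\<in>B. len b) + int (card B) - 2 * int (card (cut_first (normal_forms B) (flip s)))"
proof -
  have "{w \<in> normal_forms B. \<exists>v. w = flip s # v} = (#) (flip s) ` cut_first (normal_forms B) (flip s)"
    by (auto simp: cut_first_def)
  then show ?thesis
    using sum_len_change[OF assms(1,2) len_mult_letter_left[OF _ assms(3)]]
    by (simp add: card_image)
qed

text \<open>
  The translating element is a weighted median: at a minimum of \<open>cost\<close>, moving along any edge does not
  pay off, which says that the branch behind that edge has at most half of the total weight
  \<open>2 |A| |B|\<close>.
\<close>

lemma balanced_translate:
  assumes A: "finite A" "A \<subseteq> carrier G" and B: "finite B" "B \<subseteq> carrier G"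
  obtains A' B' where "finite A'" "A' \<subseteq> carrier G" "finite B'" "B' \<subseteq> carrier G"
    "card A' = card A" "card B' = card B" "A' <#> B' = A <#> B"
    "\<forall>s\<in>letters. card (cut_last (normal_forms A') s) * card B
       + card (cut_first (normal_forms B') (flip s)) * card A \<le> card A * card B"
proof -
  define cost where "cost g = card B * (\<Sum>a\<in>A. len (a \<otimes> inv g)) + card A * (\<Sum>b\<in>B. len (g \<otimes> b))" for g
  define g where "g = arg_min cost (\<lambda>g. g \<in> carrier G)"
  have g: "g \<in> carrier G" and min: "\<And>h. h \<in> carrier G \<Longrightarrow> cost g \<le> cost h"
    using arg_min_nat_lemma[of "\<lambda>g. g \<in> carrier G" \<one> cost] by (auto simp: g_def)
  define A' where "A' = (\<lambda>a. a \<otimes> inv g) ` A"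
  define B' where "B' = (\<lambda>b. g \<otimes> b) ` B"
  have injA: "inj_on (\<lambda>a. a \<otimes> inv g) A" and injB: "inj_on (\<lambda>b. g \<otimes> b) B"
    using A B g by (auto simp: inj_on_def subset_iff)
  have A': "finite A'" "A' \<subseteq> carrier G" "card A' = card A"
    and B': "finite B'" "B' \<subseteq> carrier G" "card B' = card B"
    using A B g injA injB by (auto simp: A'_def B'_def card_image)
  have "a \<otimes> inv g \<otimes> (g \<otimes> b) = a \<otimes> b" if "a \<in> A" "b \<in> B" for a b
    using that A B g by (auto simp: m_assoc subset_iff simp flip: m_assoc[of "inv g" g b])
  then have prod: "A' <#> B' = A <#> B"
    by (auto simp: set_mult_def A'_def B'_def)
  have bal: "card (cut_last (normal_forms A') s) * card B
       + card (cut_first (normal_forms B') (flip s)) * card A \<le> card A * card B"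
    if s: "s \<in> letters" for s
  proof -
    have s': "fst s \<in> S" using s by auto
    let ?t = "letter_val G s"
    have t: "?t \<in> carrier G" using s' by simp
    have sumA: "(\<Sum>a\<in>A'. f a) = (\<Sum>a\<in>A. f (a \<otimes> inv g))" for f :: "'a \<Rightarrow> nat"
      by (simp add: A'_def sum.reindex[OF injA])
    have sumB: "(\<Sum>b\<in>B'. f b) = (\<Sum>b\<in>B. f (g \<otimes> b))" for f :: "'a \<Rightarrow> nat"
      by (simp add: B'_def sum.reindex[OF injB])
    have 1: "(\<Sum>a\<in>A. len (a \<otimes> inv (?t \<otimes> g))) = (\<Sum>a\<in>A'. len (a \<otimes> inv ?t))"
      unfolding sumA using A g t by (intro sum.cong refl) (auto simp: inv_mult_group m_assoc subset_iff)
    have 2: "(\<Sum>b\<in>B. len (?t \<otimes> g \<otimes> b)) = (\<Sum>b\<in>B'. len (?t \<otimes> b))"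
      unfolding sumB using B g t by (intro sum.cong refl) (auto simp: m_assoc subset_iff)
    have "int (cost g) \<le> int (cost (?t \<otimes> g))"
      using min[of "?t \<otimes> g"] g t by simp
    then have "int (card B) * int (\<Sum>a\<in>A'. len a) + int (card A) * int (\<Sum>b\<in>B'. len b)
      \<le> int (card B) * int (\<Sum>a\<in>A'. len (a \<otimes> inv ?t)) + int (card A) * int (\<Sum>b\<in>B'. len (?t \<otimes> b))"
      unfolding cost_def 1 2 by (simp only: sumA sumB of_nat_add of_nat_mult)
    then have "2 * (int (card (cut_last (normal_forms A') s)) * int (card B)
       + int (card (cut_first (normal_forms B') (flip s))) * int (card A)) \<le> 2 * (int (card A) * int (card B))"
      unfolding sum_len_mult_right[OF A'(1,2) s'] sum_len_mult_left[OF B'(1,2) s'] A'(3) B'(3)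
      by (simp add: algebra_simps)
    then show ?thesis by (simp flip: of_nat_mult of_nat_add)
  qed
  show ?thesis
    by (rule that[OF A'(1,2) B'(1,2) A'(3) B'(3) prod]) (use bal in blast)
qed

lemma len_mult_le:
  assumes "a \<in> carrier G" "b \<in> carrier G"
  shows "len (a \<otimes> b) \<le> len a + len b"
proof -
  obtain u v where u: "u \<in> reduced_words S" "val u = a" and v: "v \<in> reduced_words S" "val v = b"
    using assms by (auto simp flip: val_surj)
  have w: "u \<in> words S" "v \<in> words S" using u v by (auto simp: reduced_words_def)
  obtain w' where "w' \<in> reduced_words S" "val w' = val (u @ v)" "length w' \<le> length (u @ v)"
    using reduced_form[of "u @ v"] w by auto
  then show ?thesis using len_val u v w by (metis val_append length_append)
qed

text \<open>
  The translated sets need not lie in the original balls, but their products are unchanged and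
  therefore still have length at most \<open>n + k\<close>, which is all that counting the cuts requires.
\<close>

proposition card_set_mult_ball:
  assumes A: "finite A" "A \<noteq> {}" "A \<subseteq> word_ball G S n"
    and B: "finite B" "B \<noteq> {}" "B \<subseteq> word_ball G S k"
  shows "card A * card B \<le> 2 * (n + k + 1) * card (A <#> B)"
proof -
  have cA: "A \<subseteq> carrier G" and cB: "B \<subseteq> carrier G"
    using A B by (auto simp: word_ball_def)
  obtain A' B' where A': "finite A'" "A' \<subseteq> carrier G" and B': "finite B'" "B' \<subseteq> carrier G"
    and card': "card A' = card A" "card B' = card B"
    and prod: "A' <#> B' = A <#> B"
    and bal: "\<forall>s\<in>letters. card (cut_last (normal_forms A') s) * card B
       + card (cut_first (normal_forms B') (flip s)) * card A \<le> card A * card B"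
    by (rule balanced_translate[OF A(1) cA B(1) cB]) (rule that; assumption)
  let ?U = "normal_forms A'" and ?V = "normal_forms B'"
  have cards: "card ?U = card A" "card ?V = card B"
    using card_normal_forms A' B' card' by simp_all
  have P: "products ?U ?V = A <#> B"
    using set_mult_normal_forms[OF A'(2) B'(2)] prod by simp
  have "card ?U * card ?V \<le> 2 * (n + k + 1) * card (products ?U ?V)"
  proof (rule balanced_product_bound)
    show "?U \<noteq> {}" "?V \<noteq> {}" using cards A B by (auto simp flip: card_gt_0_iff)
    show "len x \<le> n + k" if "x \<in> products ?U ?V" for x
    proof -
      from that obtain a b where ab: "a \<in> A" "b \<in> B" and x: "x = a \<otimes> b"
        unfolding P set_mult_def by blast
      have "a \<in> carrier G" "len a \<le> n" "b \<in> carrier G" "len b \<le> k"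
        using ab A(3) B(3) by (auto simp: word_ball_def)
      then show ?thesis using len_mult_le[of a b] by (simp add: x)
    qed
    show "finite ?U" "finite ?V"
      using A' B' by (simp_all add: finite_normal_forms)
    show "card (cut_last ?U s) * card ?V + card (cut_first ?V (flip s)) * card ?U \<le> card ?U * card ?V"
      if "s \<in> letters" for s
      unfolding cards by (rule bspec[OF bal that])
  qed (rule normal_forms_reduced)+
  then show ?thesis by (simp add: P cards)
qed

end

section \<open>Spheres\<close>

definition sphere_const :: "nat \<Rightarrow> real" where
  "sphere_const m = 2 / 3 + 1 / (3 * 4 ^ m)"

lemma sphere_const_bounds: "2 / 3 \<le> sphere_const m" "sphere_const m \<le> 1"
proof -
  have "(1::real) \<le> 4 ^ m" by (rule one_le_power) simp
  then show "2 / 3 \<le> sphere_const m" "sphere_const m \<le> 1"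
    by (simp_all add: sphere_const_def field_simps)
qed

lemma sphere_const_0: "sphere_const 0 = 1"
  by (simp add: sphere_const_def)

lemma sphere_const_Suc: "sphere_const (Suc m) = 1 / 2 + sphere_const m / 4"
  by (simp add: sphere_const_def field_simps)

text \<open>
  Two terms equal to \<open>1 / 2\<close> are extremal. With largest term \<open>M \<le> 1 / 2\<close>, the
  sum of squares is at most \<open>M\<close>, and \<open>M - c M\<^sup>2\<close> increases up to \<open>1 / 2\<close>. With \<open>M > 1 / 2\<close> it is at most
  \<open>M\<^sup>2 + (1 - M)\<^sup>2\<close>; the resulting bound is convex in \<open>M\<close>, so it suffices to compare the end points
  \<open>M = 1 / 2\<close> and \<open>M = 1\<close>, and the comparison at \<open>M = 1\<close> is exactly the condition \<open>c \<ge> 2 / 3\<close>.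
\<close>

lemma sum_squares_minus_max:
  fixes x :: "'l \<Rightarrow> real"
  assumes L: "finite L" "t \<in> L" and x0: "\<And>s. s \<in> L \<Longrightarrow> x s \<ge> 0"
    and x1: "sum x L \<le> 1" and max: "\<And>s. s \<in> L \<Longrightarrow> x s \<le> x t"
    and c: "2 / 3 \<le> c" "c \<le> 1"
  shows "(\<Sum>s\<in>L. (x s)\<^sup>2) - c * (x t)\<^sup>2 \<le> 1 / 2 - c / 4"
proof (cases "x t \<le> 1 / 2")
  case True
  have "(\<Sum>s\<in>L. (x s)\<^sup>2) \<le> (\<Sum>s\<in>L. x t * x s)"
    by (intro sum_mono) (auto simp: power2_eq_square intro!: mult_right_mono max x0)
  also have "\<dots> = x t * sum x L" by (simp add: sum_distrib_left)
  also have "\<dots> \<le> x t" using x0[OF L(2)] x1 by (simp add: mult_left_le)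
  finally have 1: "(\<Sum>s\<in>L. (x s)\<^sup>2) \<le> x t" .
  have "c * (1 / 2 + x t) \<le> 1 * 1"
    using True c x0[OF L(2)] by (intro mult_mono) auto
  \<comment> \<open>The product below is the gap \<open>(1 / 2 - c / 4) - (M - c * M\<^sup>2)\<close> for \<open>M = x t\<close>.\<close>
  then have "0 \<le> (1 / 2 - x t) * (1 - c * (1 / 2 + x t))"
    using True by simp
  with 1 show ?thesis by (simp add: algebra_simps power2_eq_square)
next
  case False
  have "sum x L = x t + sum x (L - {t})" by (rule sum.remove[OF L])
  with x1 have rest: "sum x (L - {t}) \<le> 1 - x t" by simp
  have small: "x s \<le> 1 - x t" if "s \<in> L - {t}" for s
    using member_le_sum[OF that, of x] x0 rest L that by force
  have xt1: "x t \<le> 1"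
    using rest sum_nonneg[of "L - {t}" x] x0 by fastforce
  have "(\<Sum>s\<in>L - {t}. (x s)\<^sup>2) \<le> (\<Sum>s\<in>L - {t}. (1 - x t) * x s)"
    by (intro sum_mono) (auto simp: power2_eq_square intro!: mult_right_mono small x0)
  also have "\<dots> = (1 - x t) * sum x (L - {t})" by (simp add: sum_distrib_left)
  also have "\<dots> \<le> (1 - x t) * (1 - x t)"
    using rest xt1 by (intro mult_left_mono) auto
  finally have squares: "(\<Sum>s\<in>L. (x s)\<^sup>2) \<le> (x t)\<^sup>2 + (1 - x t)\<^sup>2"
    using sum.remove[OF L, of "\<lambda>s. (x s)\<^sup>2"] by (simp add: power2_eq_square)
  \<comment> \<open>In terms of \<open>d\<close> the claim becomes \<open>(2 - c) * d\<^sup>2 \<le> c * d\<close>.\<close>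
  define d where "d = x t - 1 / 2"
  have d: "0 \<le> d" "d \<le> 1 / 2" using False xt1 by (auto simp: d_def)
  have "(2 - c) * d \<le> (2 - c) * (1 / 2)" using d c by (intro mult_left_mono) auto
  also have "\<dots> \<le> c" using c by simp
  finally have "d * ((2 - c) * d) \<le> d * c" using d by (intro mult_left_mono) auto
  then have "(x t)\<^sup>2 + (1 - x t)\<^sup>2 - c * (x t)\<^sup>2 \<le> 1 / 2 - c / 4"
    by (simp add: d_def field_simps power2_eq_square)
  with squares show ?thesis by linarith
qed

text \<open>
  The geometric means \<open>z\<close> of \<open>x / a\<close> and \<open>y / b\<close> have sum at most \<open>1\<close>, and their squares are the
  normalised products; this reduces the two families to one.
\<close>

lemma sum_mult_minus_max:
  fixes x y :: "'l \<Rightarrow> real"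
  assumes L: "finite L" "L \<noteq> {}"
    and x: "\<And>s. s \<in> L \<Longrightarrow> x s \<ge> 0" and y: "\<And>s. s \<in> L \<Longrightarrow> y s \<ge> 0"
    and "sum x L \<le> a" "sum y L \<le> b" "a > 0" "b > 0" and c: "2 / 3 \<le> c" "c \<le> 1"
  obtains t where "t \<in> L" "(\<Sum>s\<in>L. x s * y s) - c * (x t * y t) \<le> (1 / 2 - c / 4) * (a * b)"
proof -
  define z where "z s = sqrt ((x s / a) * (y s / b))" for s
  have z2: "(z s)\<^sup>2 = (x s * y s) / (a * b)" if "s \<in> L" for s
    using x[OF that] y[OF that] assms(7,8) by (simp add: z_def)
  have "Max (z ` L) \<in> z ` L" using L by (intro Max_in) auto
  then obtain t where t: "t \<in> L" "z t = Max (z ` L)" by force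
  have max: "z s \<le> z t" if "s \<in> L" for s
    using that L t by simp
  have z0: "z s \<ge> 0" if "s \<in> L" for s
    using x[OF that] y[OF that] assms(7,8) by (simp add: z_def)
  have "z s \<le> (x s / a + y s / b) / 2" if "s \<in> L" for s
    unfolding z_def using x[OF that] y[OF that] assms(7,8) by (intro arith_geo_mean_sqrt) auto
  then have "sum z L \<le> (\<Sum>s\<in>L. (x s / a + y s / b) / 2)" by (rule sum_mono)
  also have "\<dots> = (sum x L / a + sum y L / b) / 2"
    by (simp add: sum.distrib flip: sum_divide_distrib)
  also have "\<dots> \<le> (1 + 1) / 2"
    using assms(5-8) by (intro divide_right_mono add_mono) auto
  finally have z1: "sum z L \<le> 1" by simp
  have "(\<Sum>s\<in>L. (z s)\<^sup>2) - c * (z t)\<^sup>2 \<le> 1 / 2 - c / 4"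
    by (rule sum_squares_minus_max[OF L(1) t(1) z0 z1 max c])
  moreover have "(\<Sum>s\<in>L. (z s)\<^sup>2) = (\<Sum>s\<in>L. x s * y s) / (a * b)"
    by (simp add: z2 sum_divide_distrib)
  ultimately have "((\<Sum>s\<in>L. x s * y s) - c * (x t * y t)) / (a * b) \<le> 1 / 2 - c / 4"
    using z2[OF t(1)] by (simp add: diff_divide_distrib)
  then have "(\<Sum>s\<in>L. x s * y s) - c * (x t * y t) \<le> (1 / 2 - c / 4) * (a * b)"
    using assms(7,8) by (simp only: pos_divide_le_eq mult_pos_pos)
  with t(1) show ?thesis by (rule that)
qed

context finite_free_basis
begin

lemma products_cut:
  assumes "A \<subseteq> reduced_words S" "B \<subseteq> reduced_words S" "s \<in> letters"
  shows "products (cut_last A s) (cut_first B (flip s)) \<subseteq> (\<lambda>(a, b). val (a @ b)) ` cancelling A B"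
proof
  fix x assume "x \<in> products (cut_last A s) (cut_first B (flip s))"
  then obtain u v where uv: "u @ [s] \<in> A" "flip s # v \<in> B" "x = val (u @ v)"
    by (auto simp: products_def cut_last_def cut_first_def)
  then have "u @ [s] \<in> words S" "flip s # v \<in> words S"
    using assms(1,2) by (auto simp: reduced_words_def)
  then have "u \<in> words S" "v \<in> words S" "fst s \<in> S" by simp_all
  then have "x = val ((u @ [s]) @ (flip s # v))"
    using uv(3) val_cancel by simp
  moreover have "(u @ [s], flip s # v) \<in> cancelling A B"
    using uv by (simp add: cancelling_def)
  ultimately show "x \<in> (\<lambda>(a, b). val (a @ b)) ` cancelling A B" by force
qed

text \<open>
  The products without cancellation are distinct and have length exactly \<open>n + k\<close>, so they stay clear of
  the products that lose the letter \<open>s\<close>. The cancelling pairs stand on the right-hand side to avoid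
  truncated subtraction.
\<close>

lemma card_products_step:
  assumes A: "finite A" "A \<subseteq> reduced_words S" "\<And>a. a \<in> A \<Longrightarrow> length a = n"
    and B: "finite B" "B \<subseteq> reduced_words S" "\<And>b. b \<in> B \<Longrightarrow> length b = k"
    and s: "s \<in> letters"
  shows "card A * card B + card (products (cut_last A s) (cut_first B (flip s)))
    \<le> card (products A B) + card (cancelling A B)"
proof -
  let ?f = "\<lambda>(a, b). val (a @ b)"
  let ?D = "A \<times> B - cancelling A B" and ?P = "products (cut_last A s) (cut_first B (flip s))"
  have fin_c: "finite (cancelling A B)"
    using A B by (intro finite_subset[OF cancelling_subset]) simp
  have P: "?P \<subseteq> ?f ` cancelling A B" by (rule products_cut[OF A(2) B(2) s])
  have red: "a @ b \<in> reduced_words S" if "(a, b) \<in> ?D" for a b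
    using not_cancelling_reduced[OF A(2) B(2) that] .
  have inj: "inj_on ?f ?D"
  proof (rule inj_onI)
    fix p q assume pq: "p \<in> ?D" "q \<in> ?D" "?f p = ?f q"
    then have "length (fst p) = length (fst q)" using A(3) by auto
    then show "p = q"
      using pq by (intro inj_onD[OF splitting_determines_pair[OF A(2) B(2)]]) (auto split: prod.splits)
  qed
  have long: "len x = n + k" if "x \<in> ?f ` ?D" for x
  proof -
    from that obtain p where p: "p \<in> ?D" "x = ?f p" by blast
    obtain a b where "p = (a, b)" by (cases p)
    with p have ab: "(a, b) \<in> ?D" "x = val (a @ b)" by simp_all
    then show ?thesis using A(3) B(3) by (simp add: len_val[OF red[OF ab(1)]])
  qed
  have short: "len x < n + k" if "x \<in> ?P" for x
  proof -
    from that obtain u v where uv: "u @ [s] \<in> A" "flip s # v \<in> B" "x = val (u @ v)"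
      by (auto simp: products_def cut_last_def cut_first_def)
    then have "u @ v \<in> words S" using A(2) B(2) by (auto simp: reduced_words_def)
    then obtain w where "w \<in> reduced_words S" "val w = x" "length w \<le> length (u @ v)"
      using reduced_form uv(3) by metis
    then have "len x \<le> length u + length v" using len_val by auto
    then show ?thesis using A(3)[OF uv(1)] B(3)[OF uv(2)] by simp
  qed
  have "card ?D + card ?P = card (?f ` ?D) + card ?P"
    by (simp add: card_image[OF inj])
  also have "\<dots> = card (?f ` ?D \<union> ?P)"
  proof (rule card_Un_disjoint[symmetric])
    show "finite (?f ` ?D)" using A B by simp
    show "finite ?P" using P fin_c finite_subset by blast
    show "?f ` ?D \<inter> ?P = {}" using long short by fastforce
  qed
  also have "\<dots> \<le> card (products A B)"
  proof (rule card_mono)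
    show "finite (products A B)" using A B by (simp add: products_def)
    have "?f ` cancelling A B \<subseteq> products A B"
      unfolding products_def by (rule image_mono[OF cancelling_subset])
    moreover have "?f ` ?D \<subseteq> products A B"
      unfolding products_def by (rule image_mono) blast
    ultimately show "?f ` ?D \<union> ?P \<subseteq> products A B" using P by simp
  qed
  finally have "card ?D + card ?P \<le> card (products A B)" .
  moreover have "card ?D = card A * card B - card (cancelling A B)"
    using fin_c by (simp add: card_Diff_subset cancelling_subset card_cartesian_product)
  ultimately show ?thesis by linarith
qed

text \<open>
  Among the letters, the induction keeps only the product set of a letter \<open>t\<close> for which
  \<open>x\<^sub>t y\<^sub>t\<close> is largest; the product sets of the other letters may overlap with it.
\<close>

lemma card_products_sphere:
  assumes "S \<noteq> {}"
    and "finite A" "A \<subseteq> reduced_words S" "\<And>a. a \<in> A \<Longrightarrow> length a = n"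
    and "finite B" "B \<subseteq> reduced_words S" "\<And>b. b \<in> B \<Longrightarrow> length b = k"
  shows "sphere_const (min n k) * (real (card A) * real (card B)) \<le> real (card (products A B))"
  using assms(2-)
proof (induction n arbitrary: k A B)
  case 0
  have "A \<subseteq> {[]}" using 0(3) by blast
  then consider "A = {}" | "A = {[]}" by blast
  then show ?case
  proof cases
    case 2
    then have "products A B = val ` B" by (force simp: products_def)
    then show ?thesis
      using 2 card_image[OF inj_on_subset[OF val_inj 0(5)]] by (simp add: sphere_const_0)
  qed simp
next
  case (Suc n)
  note A = Suc.prems(1-3) and B = Suc.prems(4-6)
  show ?case
  proof (cases k)
    case 0
    have "B \<subseteq> {[]}" using B 0 by auto
    then consider "B = {}" | "B = {[]}" by blast
    then show ?thesis
    proof cases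
      case 2
      then have "products A B = val ` A" by (force simp: products_def)
      then show ?thesis
        using 2 0 card_image[OF inj_on_subset[OF val_inj A(2)]] by (simp add: sphere_const_0)
    qed simp
  next
    case k: (Suc k')
    show ?thesis
    proof (cases "A = {} \<or> B = {}")
      case False
      let ?c = "sphere_const (min n k')"
      have pos: "real (card A) > 0" "real (card B) > 0"
        using False A(1) B(1) by (auto simp: card_gt_0_iff)
      have fL: "finite letters" "letters \<noteq> {}" using fin assms(1) by auto
      define x where "x s = real (card (cut_last A s))" for s
      define y where "y s = real (card (cut_first B (flip s)))" for s
      have sums: "sum x letters \<le> real (card A)" "sum y letters \<le> real (card B)"
        using sum_card_cut_last[OF A(1) fL(1)] sum_card_cut_first[OF B(1) fL(1)]
        by (simp_all add: x_def y_def flip: of_nat_sum)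
      have nonneg: "x s \<ge> 0" "y s \<ge> 0" for s by (simp_all add: x_def y_def)
      obtain t where t: "t \<in> letters"
        and le: "(\<Sum>s\<in>letters. x s * y s) - ?c * (x t * y t)
          \<le> (1 / 2 - ?c / 4) * (real (card A) * real (card B))"
        by (rule sum_mult_minus_max[OF fL nonneg sums pos sphere_const_bounds[of "min n k'"]])
      let ?A = "cut_last A t" and ?B = "cut_first B (flip t)"
      have "?c * (x t * y t) \<le> real (card (products ?A ?B))"
        unfolding x_def y_def
      proof (rule Suc.IH)
        show "?A \<subseteq> reduced_words S" "?B \<subseteq> reduced_words S"
          using A(2) B(2)
          by (auto simp: cut_last_def cut_first_def reduced_words_def reduced_append reduced_Cons)
        show "length a = n" if "a \<in> ?A" for a using A(3) that by (force simp: cut_last_def)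
        show "length b = k'" if "b \<in> ?B" for b using B(3) that k by (force simp: cut_first_def)
      qed (use A(1) B(1) in \<open>auto intro: finite_cut_last finite_cut_first\<close>)
      moreover have "real (card A) * real (card B) + real (card (products ?A ?B))
          \<le> real (card (products A B)) + real (card (cancelling A B))"
        using card_products_step[OF A B t] by (simp flip: of_nat_mult of_nat_add)
      moreover have "real (card (cancelling A B)) = (\<Sum>s\<in>letters. x s * y s)"
        by (subst card_cancelling[OF A(1) B(1) fL(1) reduced_words_letters[OF A(2)]])
           (simp_all add: x_def y_def)
      moreover have "sphere_const (min (Suc n) k) * (real (card A) * real (card B))
          = real (card A) * real (card B) - (1 / 2 - ?c / 4) * (real (card A) * real (card B))"
        using k by (simp add: sphere_const_Suc algebra_simps)
      ultimately show ?thesis using le by linarith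
    qed auto
  qed
qed

proposition card_set_mult_sphere:
  assumes "S \<noteq> {}"
    and A: "finite A" "A \<subseteq> word_sphere G S n" and B: "finite B" "B \<subseteq> word_sphere G S k"
  shows "sphere_const (min n k) * (real (card A) * real (card B)) \<le> real (card (A <#> B))"
proof -
  have cA: "A \<subseteq> carrier G" and cB: "B \<subseteq> carrier G"
    using A B by (auto simp: word_sphere_def)
  have "length w = n" if "w \<in> normal_forms A" for w
    using that A len_val by (auto simp: normal_forms_def word_sphere_def)
  moreover have "length w = k" if "w \<in> normal_forms B" for w
    using that B len_val by (auto simp: normal_forms_def word_sphere_def)
  ultimately have "sphere_const (min n k) * (real (card (normal_forms A)) * real (card (normal_forms B)))
      \<le> real (card (products (normal_forms A) (normal_forms B)))"
    by (intro card_products_sphere[OF assms(1)] finite_normal_forms[OF cA A(1)]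
        finite_normal_forms[OF cB B(1)] normal_forms_reduced) simp_all
  then show ?thesis
    by (simp add: card_normal_forms cA cB set_mult_normal_forms)
qed

end

section \<open>Sharpness\<close>

definition signed_words :: "'a set \<Rightarrow> bool \<Rightarrow> nat \<Rightarrow> ('a \<times> bool) list set" where
  "signed_words X e m = {w. set w \<subseteq> X \<times> {e} \<and> length w = m}"

lemma finite_signed_words: "finite X \<Longrightarrow> finite (signed_words X e m)"
  by (simp add: signed_words_def finite_lists_length_eq)

lemma card_signed_words: "finite X \<Longrightarrow> card (signed_words X e m) = card X ^ m"
  by (simp add: signed_words_def card_lists_length_eq card_cartesian_product)

context finite_free_basis
begin

text \<open>Letters of equal sign never cancel.\<close>

lemma signed_words_reduced:
  assumes "X \<subseteq> S"
  shows "signed_words X e m \<subseteq> reduced_words S"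
proof
  fix w assume "w \<in> signed_words X e m"
  then have "set w \<subseteq> X \<times> {e}" by (simp add: signed_words_def)
  then show "w \<in> reduced_words S"
    using assms
  proof (induction w)
    case (Cons l w)
    have "hd w \<noteq> flip l" if "w \<noteq> []"
    proof -
      have "hd w \<in> X \<times> {e}" "l \<in> X \<times> {e}" using Cons.prems(1) hd_in_set[OF that] by auto
      then show ?thesis by (auto simp: flip_def)
    qed
    then show ?case using Cons by (auto simp: reduced_words_def reduced_Cons)
  qed (simp add: reduced_words_def)
qed

text \<open>
  Going from \<open>m\<close> to \<open>m + 1\<close>, a pair either cancels at the junction and has a product already counted
  for \<open>m\<close>, or it has one of two junctions without cancellation between arbitrary words of length
  \<open>m\<close>. So the count grows by at most \<open>2 \<sqdot> 4\<^sup>m\<close>.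
\<close>

lemma card_products_signed_words:
  assumes xy: "x \<in> S" "y \<in> S" "x \<noteq> y"
  shows "3 * card (products (signed_words {x, y} True m) (signed_words {x, y} False m)) \<le> 2 * 4 ^ m + 1"
proof (induction m)
  case 0
  have "signed_words {x, y} e 0 = {[]}" for e by (auto simp: signed_words_def)
  then show ?case by (simp add: products_def)
next
  case (Suc m)
  let ?A = "signed_words {x, y} True" and ?B = "signed_words {x, y} False"
  let ?Q = "{[(x, True), (y, False)], [(y, True), (x, False)]}"
  let ?F = "\<lambda>(u, q, v). val (u @ q @ v)"
  have "products (?A (Suc m)) (?B (Suc m)) \<subseteq> products (?A m) (?B m) \<union> ?F ` (?A m \<times> ?Q \<times> ?B m)"
  proof
    fix g assume "g \<in> products (?A (Suc m)) (?B (Suc m))"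
    then obtain a b where ab: "a \<in> ?A (Suc m)" "b \<in> ?B (Suc m)" and g: "g = val (a @ b)"
      by (auto simp: products_def)
    obtain u p where a: "a = u @ [p]" using ab(1) by (cases a rule: rev_cases) (auto simp: signed_words_def)
    obtain q v where b: "b = q # v" using ab(2) by (cases b) (auto simp: signed_words_def)
    have u: "u \<in> ?A m" and v: "v \<in> ?B m" using ab by (auto simp: signed_words_def a b)
    then have w: "u \<in> words S" "v \<in> words S"
      using signed_words_reduced[of "{x, y}"] xy by (auto simp: reduced_words_def)
    have pq: "p = (x, True) \<or> p = (y, True)" "q = (x, False) \<or> q = (y, False)"
      using ab by (auto simp: signed_words_def a b)
    show "g \<in> products (?A m) (?B m) \<union> ?F ` (?A m \<times> ?Q \<times> ?B m)"
    proof (cases "q = flip p")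
      case True
      moreover have "fst p \<in> S" using pq(1) xy by auto
      ultimately have "g = val (u @ v)" using val_cancel[OF w, of p] by (simp add: g a b)
      then show ?thesis using u v by (auto simp: products_def)
    next
      case False
      then have "[p, q] \<in> ?Q" using pq by (auto simp: flip_def)
      moreover have "g = ?F (u, [p, q], v)" by (simp add: g a b)
      ultimately show ?thesis using u v by blast
    qed
  qed
  then have "card (products (?A (Suc m)) (?B (Suc m)))
      \<le> card (products (?A m) (?B m) \<union> ?F ` (?A m \<times> ?Q \<times> ?B m))"
    by (intro card_mono) (auto simp: products_def finite_signed_words)
  also have "\<dots> \<le> card (products (?A m) (?B m)) + card (?F ` (?A m \<times> ?Q \<times> ?B m))"
    by (rule card_Un_le)
  also have "card (?F ` (?A m \<times> ?Q \<times> ?B m)) \<le> card (?A m \<times> ?Q \<times> ?B m)"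
    by (rule card_image_le) (auto simp: finite_signed_words)
  also have "\<dots> = 2 * 4 ^ m"
  proof -
    have "card {x, y} = 2" "card ?Q = 2" using xy by simp_all
    then have "card (?A m \<times> ?Q \<times> ?B m) = 2 ^ m * (2 * 2 ^ m)"
      by (simp only: card_cartesian_product card_signed_words finite.intros)
    then show ?thesis by (simp flip: power_mult_distrib)
  qed
  finally show ?case using Suc.IH by simp
qed

proposition sphere_const_attained:
  assumes xy: "x \<in> S" "y \<in> S" "x \<noteq> y"
  obtains A B where "finite A" "A \<noteq> {}" "A \<subseteq> word_sphere G S m"
    "finite B" "B \<noteq> {}" "B \<subseteq> word_sphere G S m"
    "real (card (A <#> B)) \<le> sphere_const m * (real (card A) * real (card B))"
proof -
  let ?A = "signed_words {x, y} True m" and ?B = "signed_words {x, y} False m"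
  have red: "?A \<subseteq> reduced_words S" "?B \<subseteq> reduced_words S"
    using signed_words_reduced xy by auto
  have card_2: "card {x, y} = 2" using xy by simp
  have card: "card (val ` ?A) = 2 ^ m" "card (val ` ?B) = 2 ^ m"
    using red card_2 by (simp_all only: card_image[OF inj_on_subset[OF val_inj]] card_signed_words
        finite.intros)
  have sph: "val ` signed_words {x, y} e m \<subseteq> word_sphere G S m" for e
  proof (rule image_subsetI)
    fix w assume w: "w \<in> signed_words {x, y} e m"
    moreover have "signed_words {x, y} e m \<subseteq> reduced_words S"
      using xy by (intro signed_words_reduced) simp
    ultimately have "w \<in> reduced_words S" by auto
    then show "val w \<in> word_sphere G S m"
      using w by (simp add: word_sphere_def len_val signed_words_def) (simp add: reduced_words_def)
  qed
  have "val ` ?A <#> val ` ?B = products ?A ?B"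
    using red by (intro products_eq_set_mult[symmetric]) (auto simp: reduced_words_def)
  then have "3 * card (val ` ?A <#> val ` ?B) \<le> 2 * 4 ^ m + 1"
    using card_products_signed_words[OF xy, of m] by simp
  then have "real (3 * card (val ` ?A <#> val ` ?B)) \<le> real (2 * 4 ^ m + 1)"
    by (simp only: of_nat_le_iff)
  then have "real (card (val ` ?A <#> val ` ?B))
      \<le> sphere_const m * (real (card (val ` ?A)) * real (card (val ` ?B)))"
  proof -
    have "sphere_const m * 4 ^ m = (2 * 4 ^ m + 1) / 3"
      by (simp add: sphere_const_def distrib_right)
    moreover have "real (2 ^ m) * real (2 ^ m) = 4 ^ m"
      by (simp flip: power_mult_distrib)
    ultimately show ?thesis
      using \<open>real (3 * _) \<le> _\<close> unfolding card by (simp add: field_simps)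
  qed
  moreover have "val ` ?A \<noteq> {}" "val ` ?B \<noteq> {}"
    using card by (auto simp flip: card_gt_0_iff)
  moreover have "finite (val ` ?A)" "finite (val ` ?B)"
    by (simp_all add: finite_signed_words)
  ultimately show ?thesis using sph by (intro that[of "val ` ?A" "val ` ?B"])
qed

end

section \<open>Product sets in balls and spheres\<close>

theorem theorem1p4:
  fixes G :: "('a, 'b) monoid_scheme" and S :: "'a set" and r :: nat
  assumes "r \<ge> 2" and "free_generating_set G S" and "card S = r"
  shows
    "(\<forall>(n::nat) (k::nat) A B.
        finite A \<and> A \<noteq> {} \<and> finite B \<and> B \<noteq> {} \<and>
        A \<subseteq> word_ball G S n \<and> B \<subseteq> word_ball G S k \<longrightarrow>
        real (card (A <#>\<^bsub>G\<^esub> B)) \<ge> real (card A) * real (card B) / (4 * (real n + real k) + 1))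
   \<and> (\<forall>(n::nat) (k::nat) A B.
        finite A \<and> A \<noteq> {} \<and> finite B \<and> B \<noteq> {} \<and>
        A \<subseteq> word_sphere G S n \<and> B \<subseteq> word_sphere G S k \<longrightarrow>
        real (card (A <#>\<^bsub>G\<^esub> B)) \<ge> (2 / 3 + 1 / (3 * 4 ^ min n k)) * real (card A) * real (card B))
   \<and> (\<forall>(m::nat) (c::real). c > 2 / 3 + 1 / (3 * 4 ^ m) \<longrightarrow>
        \<not> (\<forall>(n::nat) (k::nat) A B.
              min n k = m \<and>
              finite A \<and> A \<noteq> {} \<and> finite B \<and> B \<noteq> {} \<and>
              A \<subseteq> word_sphere G S n \<and> B \<subseteq> word_sphere G S k \<longrightarrow>
              real (card (A <#>\<^bsub>G\<^esub> B)) \<ge> c * real (card A) * real (card B)))"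
proof -
  have fin: "finite S" using assms(1,3) by (intro card_ge_0_finite) simp
  have basis: "finite_free_basis G S"
    using assms(2) fin by (simp add: finite_free_basis_def finite_free_basis_axioms_def free_basis_def)
  obtain x y where xy: "x \<in> S" "y \<in> S" "x \<noteq> y"
  proof -
    obtain T where "T \<subseteq> S" "card T = 2"
      by (rule obtain_subset_with_card_n[of 2 S]) (simp_all only: assms(1,3))
    then show ?thesis using that by (auto simp: card_2_iff)
  qed
  have sphere: "sphere_const (min n k) * (real (card A) * real (card B)) \<le> real (card (A <#>\<^bsub>G\<^esub> B))"
    if "finite A" "A \<subseteq> word_sphere G S n" "finite B" "B \<subseteq> word_sphere G S k" for n k A B
    using finite_free_basis.card_set_mult_sphere[OF basis _ that] xy by blast
  have ball: "real (card A) * real (card B) / (4 * (real n + real k) + 1) \<le> real (card (A <#>\<^bsub>G\<^esub> B))"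
    if A: "finite A" "A \<noteq> {}" "A \<subseteq> word_ball G S n"
      and B: "finite B" "B \<noteq> {}" "B \<subseteq> word_ball G S k" for n k A B
  proof (cases "n + k = 0")
    case True
    \<comment> \<open>Here \<open>2 (n + k + 1)\<close> exceeds \<open>4 (n + k) + 1\<close>, but balls of radius \<open>0\<close> are spheres.\<close>
    then have "A \<subseteq> word_sphere G S 0" "B \<subseteq> word_sphere G S 0"
      using A B by (auto simp: word_ball_def word_sphere_def)
    then show ?thesis
      using sphere[OF A(1) _ B(1), of 0 0] True by (simp add: sphere_const_0)
  next
    case False
    then have "2 * (n + k + 1) \<le> 4 * (n + k) + 1" by presburger
    from order_trans[OF finite_free_basis.card_set_mult_ball[OF basis A B] mult_le_mono1[OF this]]
    have "card A * card B \<le> (4 * (n + k) + 1) * card (A <#>\<^bsub>G\<^esub> B)" .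
    then have "real (card A * card B) \<le> real ((4 * (n + k) + 1) * card (A <#>\<^bsub>G\<^esub> B))"
      by (simp only: of_nat_le_iff)
    then show ?thesis by (simp add: pos_divide_le_eq algebra_simps)
  qed
  have sharp: "\<not> (\<forall>n k A B. min n k = m \<and> finite A \<and> A \<noteq> {} \<and> finite B \<and> B \<noteq> {} \<and>
      A \<subseteq> word_sphere G S n \<and> B \<subseteq> word_sphere G S k \<longrightarrow>
      real (card (A <#>\<^bsub>G\<^esub> B)) \<ge> c * real (card A) * real (card B))"
    if c: "c > sphere_const m" for m c
  proof
    assume H: "\<forall>n k A B. min n k = m \<and> finite A \<and> A \<noteq> {} \<and> finite B \<and> B \<noteq> {} \<and>
      A \<subseteq> word_sphere G S n \<and> B \<subseteq> word_sphere G S k \<longrightarrow>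
      real (card (A <#>\<^bsub>G\<^esub> B)) \<ge> c * real (card A) * real (card B)"
    obtain A B where AB: "finite A" "A \<noteq> {}" "A \<subseteq> word_sphere G S m"
      "finite B" "B \<noteq> {}" "B \<subseteq> word_sphere G S m"
      and le: "real (card (A <#>\<^bsub>G\<^esub> B)) \<le> sphere_const m * (real (card A) * real (card B))"
      using finite_free_basis.sphere_const_attained[OF basis xy] by blast
    have "c * (real (card A) * real (card B)) \<le> real (card (A <#>\<^bsub>G\<^esub> B))"
      using H[rule_format, of m m A B] AB by (simp add: mult.assoc)
    also note le
    finally have "c * (real (card A) * real (card B)) \<le> sphere_const m * (real (card A) * real (card B))" .
    moreover have "real (card A) * real (card B) > 0" using AB by (simp add: card_gt_0_iff)
    ultimately show False using c by (simp add: mult_le_cancel_right)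
  qed
  show ?thesis
    using ball sphere sharp unfolding sphere_const_def mult.assoc by simp
qed

end
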